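(* Every $C_3$-free $1$-planar graph with $n\ge 4$ vertices has at most $3(n-2)$ edges.
   Context: All graphs are finite and simple. A graph is $k$-planar if it admits a drawing in the plane in which every edge is crossed at most $k$ times. A graph is $C_\ell$-free if it contains no cycle of length $\ell$ as a subgraph. *)

theory Defs
  imports "HOL-Analysis.Analysis"
begin

definition simple_graph :: "'a set \<Rightarrow> 'a set set \<Rightarrow> bool" where
  "simple_graph V E \<longleftrightarrow> finite V \<and> (\<forall>e\<in>E. e \<subseteq> V \<and> card e = 2)"

definition arc_interior :: "(real \<Rightarrow> real \<times> real) \<Rightarrow> (real \<times> real) set" where
  "arc_interior g = g ` {0<..<1}"

definition crossings ::
  "'a set set \<Rightarrow> ('a set \<Rightarrow> real \<Rightarrow> real \<times> real) \<Rightarrow> 'a set \<Rightarrow> ('a set \<times> (real \<times> real)) set" where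
  "crossings E \<gamma> e = {(f, p). f \<in> E \<and> f \<noteq> e \<and> p \<in> arc_interior (\<gamma> e) \<and> p \<in> arc_interior (\<gamma> f)}"

definition k_planar_drawing ::
  "nat \<Rightarrow> 'a set \<Rightarrow> 'a set set \<Rightarrow> ('a \<Rightarrow> real \<times> real) \<Rightarrow> ('a set \<Rightarrow> real \<Rightarrow> real \<times> real) \<Rightarrow> bool" where
  "k_planar_drawing k V E pos \<gamma> \<longleftrightarrow>
     inj_on pos V \<and>
     (\<forall>e\<in>E. arc (\<gamma> e) \<and>
        (\<exists>u v. e = {u, v} \<and> pathstart (\<gamma> e) = pos u \<and> pathfinish (\<gamma> e) = pos v) \<and>
        (\<forall>x\<in>V. pos x \<notin> arc_interior (\<gamma> e))) \<and>
     (\<forall>e\<in>E. finite (crossings E \<gamma> e) \<and> card (crossings E \<gamma> e) \<le> k)"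

definition k_planar :: "nat \<Rightarrow> 'a set \<Rightarrow> 'a set set \<Rightarrow> bool" where
  "k_planar k V E \<longleftrightarrow> (\<exists>pos \<gamma>. k_planar_drawing k V E pos \<gamma>)"

definition triangle_free :: "'a set set \<Rightarrow> bool" where
  "triangle_free E \<longleftrightarrow>
     \<not> (\<exists>u v w. u \<noteq> v \<and> v \<noteq> w \<and> u \<noteq> w \<and> {u, v} \<in> E \<and> {v, w} \<in> E \<and> {u, w} \<in> E)"

end

theory Submission
  imports Defs
begin

text \<open>
  Everything rests on one bound for a plane graph with vertex set \<^term>\<open>P\<close>, edge set \<^term>\<open>I\<close> and
  a set \<^term>\<open>W\<close> of edges such that every nonempty edge set without leaves contains at least \<^term>\<open>k\<close>
  edges of \<^term>\<open>W\<close>. Adding the edges one at a time gives Euler's inequality (faces + vertices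
  \<open>\<ge>\<close> edges + 2): by the Jordan curve theorem an edge that closes a cycle splits a face. By Janiszewski's theorem
  an edge lies on the boundary of at most two faces, and a forest does not separate the plane, so
  with at least two faces every face boundary contains a nonempty edge set without leaves. Double
  counting then bounds the number of edges.

  With \<open>k = 4\<close> this is used twice. The half edges at the \<open>c\<close> crossings of pairs of disjoint edges
  form a bipartite plane graph with \<open>n + c\<close> vertices and \<open>4c\<close> edges, whence \<open>c \<le> n - 2\<close>. Deleting one
  edge from each of these crossings leaves \<open>m - c\<close> edges, and \<open>m - c \<le> 2n - 4\<close>. In this second graph
  edges \<open>ab\<close>, \<open>ad\<close> that cross in a point \<open>x\<close> become a star with centre \<open>x\<close>, in which \<open>xb\<close> and \<open>xd\<close>
  have weight one and \<open>xa\<close> has weight zero.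
\<close>

subsection \<open>Arcs and separation in the plane\<close>

text \<open>The inverse of an arc would map a nonempty open set of the plane continuously and
  injectively into the real line, against invariance of dimension.\<close>

lemma interior_arc_image_empty:
  fixes g :: "real \<Rightarrow> complex"
  assumes "arc g"
  shows "interior (path_image g) = {}"
proof (rule ccontr)
  assume ne: "interior (path_image g) \<noteq> {}"
  let ?h = "inv_into {0..1} g"
  have "continuous_on (path_image g) ?h"
    unfolding path_image_def using assms
    by (intro continuous_on_inv) (auto simp: arc_def path_def)
  then have "continuous_on (interior (path_image g)) ?h"
    using continuous_on_subset interior_subset by blast
  moreover have "inj_on ?h (interior (path_image g))"
    using inj_on_inv_into inj_on_subset interior_subset unfolding path_image_def by metis
  ultimately have "DIM(complex) \<le> DIM(real)"
    using ne invariance_of_dimension open_interior by blast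
  then show False by simp
qed

definition open_arc :: "(real \<Rightarrow> 'a::topological_space) \<Rightarrow> 'a set" where
  "open_arc g = g ` {0<..<1}"

lemma path_image_open_arc: "path_image g = open_arc g \<union> {pathstart g, pathfinish g}"
proof -
  have "{0..1::real} = {0<..<1} \<union> {0, 1}" by auto
  then show ?thesis unfolding path_image_def open_arc_def pathstart_def pathfinish_def by auto
qed

lemma connected_open_arc:
  assumes "path g" shows "connected (open_arc g)"
  using assms unfolding open_arc_def path_def
  by (intro connected_continuous_image) (auto intro: continuous_on_subset)

lemma connected_component_arc_complement:
  fixes g :: "real \<Rightarrow> complex"
  assumes "arc g" "a \<notin> path_image g" "b \<notin> path_image g"
  shows "connected_component (- path_image g) a b"
  using connected_arc_complement[OF assms(1)] assms(2,3)
  by (auto simp: connected_iff_connected_component)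

text \<open>Janiszewski's theorem asks for a connected intersection, and a set with at most one
  point is connected.\<close>

lemma Janiszewski_subsingleton:
  fixes a b :: complex
  assumes "compact S" "closed T" "S \<inter> T \<subseteq> {x}"
    and "connected_component (- S) a b" "connected_component (- T) a b"
  shows "connected_component (- (S \<union> T)) a b"
proof (rule Janiszewski)
  show "connected (S \<inter> T)" using assms(3) by (metis connected_empty connected_sing subset_singletonD)
qed (use assms in auto)

text \<open>The arc is glued first to \<open>K\<^sub>1\<close>, which it meets in at most
  \<open>p\<close>; the union is then glued to \<open>K\<^sub>2\<close>, which it meets in at most
  \<open>q\<close>. Janiszewski's theorem applies both times.\<close>

lemma connected_component_add_linking_arc:
  fixes g :: "real \<Rightarrow> complex"
  assumes K: "compact K\<^sub>1" "compact K\<^sub>2" "K\<^sub>1 \<inter> K\<^sub>2 = {}" and g: "arc g"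
    and 1: "path_image g \<inter> K\<^sub>1 \<subseteq> {p}" and 2: "path_image g \<inter> K\<^sub>2 \<subseteq> {q}"
    and ab: "connected_component (- (K\<^sub>1 \<union> K\<^sub>2)) a b" "a \<notin> path_image g" "b \<notin> path_image g"
  shows "connected_component (- (K\<^sub>1 \<union> K\<^sub>2 \<union> path_image g)) a b"
proof -
  have sub: "connected_component (- K\<^sub>1) a b" "connected_component (- K\<^sub>2) a b"
    using connected_component_of_subset[OF ab(1)] by auto
  have "connected_component (- (path_image g \<union> K\<^sub>1)) a b"
    by (rule Janiszewski_subsingleton[OF compact_arc_image[OF g] compact_imp_closed[OF K(1)] 1
        connected_component_arc_complement[OF g ab(2,3)] sub(1)])
  moreover have "(path_image g \<union> K\<^sub>1) \<inter> K\<^sub>2 \<subseteq> {q}" using K(3) 2 by auto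
  ultimately have "connected_component (- ((path_image g \<union> K\<^sub>1) \<union> K\<^sub>2)) a b"
    using Janiszewski_subsingleton[OF compact_Un[OF compact_arc_image[OF g] K(1)] compact_imp_closed[OF K(2)]]
      sub(2) by blast
  then show ?thesis by (simp add: Un_ac)
qed

text \<open>\<open>d\<close> is a way back inside \<open>K\<close>, so that \<open>g\<close> and
  \<open>d\<close> together form a Jordan curve meeting \<open>K\<close> exactly in
  \<open>d\<close>.\<close>

locale closing_arc =
  fixes K :: "complex set" and g d :: "real \<Rightarrow> complex"
  assumes closed_K: "closed K" and g: "arc g" and d: "arc d"
    and dK: "path_image d \<subseteq> K"
    and ends: "pathstart d = pathfinish g" "pathfinish d = pathstart g"
    and gK: "open_arc g \<inter> K = {}"
begin

definition loop where "loop = path_image (g +++ d)"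

lemma loop_eq: "loop = path_image g \<union> path_image d"
  unfolding loop_def by (simp add: path_image_join ends)

lemma loop: "simple_path (g +++ d)" "pathfinish (g +++ d) = pathstart (g +++ d)"
  using g d ends gK dK
  by (auto intro!: simple_path_join_loop simp: path_image_open_arc[of g])

lemma Jordan:
  "open (inside loop)" "open (outside loop)"
  "connected (inside loop)" "connected (outside loop)"
  "inside loop \<inter> outside loop = {}" "inside loop \<union> outside loop = - loop"
  "frontier (inside loop) = loop" "frontier (outside loop) = loop"
  using Jordan_inside_outside[OF loop] unfolding loop_def by simp_all

lemma loop_Int: "loop \<inter> K = path_image d"
proof -
  have "pathstart g \<in> path_image d" "pathfinish g \<in> path_image d"
    using ends by (metis pathfinish_in_path_image, metis pathstart_in_path_image)
  then show ?thesis
    unfolding loop_eq path_image_open_arc[of g] using dK gK by auto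
qed

lemma K_Un_loop: "K \<union> loop = K \<union> path_image g"
  unfolding loop_eq using dK by auto

text \<open>\<open>loop\<close> and \<open>K\<close> meet in the connected set
  \<open>path_image d\<close>, so Janiszewski's theorem applies to them.\<close>

lemma same_side:
  assumes "connected_component (- K) a b" "connected_component (- loop) a b"
  shows "connected_component (- (K \<union> path_image g)) a b"
proof -
  have "connected_component (- (loop \<union> K)) a b"
    using assms closed_K loop_Int compact_simple_path_image[OF loop(1)] connected_arc_image[OF d]
    by (intro Janiszewski) (auto simp: loop_def)
  then show ?thesis by (metis K_Un_loop Un_commute)
qed

text \<open>A Jordan curve has two sides, so two of the three points share one;
  \<open>same_side\<close> then brings in the rest of \<open>K\<close>.\<close>

lemma at_most_two_sides:
  assumes "connected_component (- K) a b" "connected_component (- K) b c"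
    and "a \<notin> path_image g" "b \<notin> path_image g" "c \<notin> path_image g"
  shows "connected_component (- (K \<union> path_image g)) a b \<or>
    connected_component (- (K \<union> path_image g)) b c \<or>
    connected_component (- (K \<union> path_image g)) a c"
proof -
  have "a \<notin> K" "b \<notin> K" "c \<notin> K"
    using assms(1,2) by (auto dest: connected_component_in)
  then have "a \<notin> loop" "b \<notin> loop" "c \<notin> loop"
    using assms dK unfolding loop_eq by auto
  then have mem: "x \<in> inside loop \<or> x \<in> outside loop" if "x \<in> {a,b,c}" for x
    using Jordan(6) that by blast
  have side: "connected_component (- loop) x y"
    if "x \<in> S \<and> y \<in> S" "S = inside loop \<or> S = outside loop" for x y S
    using that Jordan(3,4,6) unfolding connected_component_def by (metis Un_upper1 Un_upper2)
  have "connected_component (- K) a c"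
    using assms(1,2) connected_component_trans by metis
  moreover have "connected_component (- loop) a b \<or> connected_component (- loop) b c \<or>
      connected_component (- loop) a c"
    using mem side by (metis insertCI)
  ultimately show ?thesis using same_side assms(1,2) by blast
qed

text \<open>Both sides of \<open>loop\<close> accumulate at the midpoint \<open>m\<close> of
  \<open>g\<close>, and a small ball about \<open>m\<close> misses \<open>K\<close>. Points of the
  ball on different sides are thus joined off \<open>K\<close> and separated by \<open>loop\<close>.
  The thin set \<open>X\<close> allows both points to be chosen off a whole drawing.\<close>

lemma separates:
  assumes "interior X = {}" "closed X"
  obtains z w where "z \<notin> X" "w \<notin> X" "z \<notin> K \<union> path_image g" "w \<notin> K \<union> path_image g"
    "connected_component (- K) z w" "\<not> connected_component (- (K \<union> path_image g)) z w"
proof -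
  define m where "m = g (1/2)"
  have m: "m \<in> open_arc g" unfolding m_def open_arc_def by auto
  then have "m \<in> - K" using gK by auto
  then obtain r where r: "r > 0" "ball m r \<subseteq> - K"
    using closed_K open_contains_ball by (metis open_Compl)
  have mloop: "m \<in> loop" using m unfolding loop_eq path_image_open_arc[of g] by auto
  have pick: "\<exists>z. z \<in> S \<and> z \<in> ball m r \<and> z \<notin> X" if "open S" "frontier S = loop" for S
  proof -
    have "m \<in> closure S" using that mloop unfolding frontier_def by auto
    then have "S \<inter> ball m r \<noteq> {}"
      using r(1) by (metis centre_in_ball closure_iff_nhds_not_empty disjoint_iff open_ball subset_refl)
    then have "\<not> S \<inter> ball m r \<subseteq> X"
      using that assms(1) interior_maximal[of "S \<inter> ball m r" X] by auto
    then show ?thesis by auto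
  qed
  obtain z where z: "z \<in> inside loop" "z \<in> ball m r" "z \<notin> X" using pick[of "inside loop"] Jordan by blast
  obtain w where w: "w \<in> outside loop" "w \<in> ball m r" "w \<notin> X" using pick[of "outside loop"] Jordan by blast
  have zw: "z \<notin> loop" "w \<notin> loop" using Jordan(6) z w by blast+
  have "\<not> connected_component (- loop) z w"
  proof
    assume "connected_component (- loop) z w"
    then obtain T where T: "connected T" "T \<subseteq> - loop" "z \<in> T" "w \<in> T"
      unfolding connected_component_def by auto
    then have "T \<inter> frontier (inside loop) \<noteq> {}"
      using z w Jordan(5) by (intro connected_Int_frontier) blast+
    then show False using T(2) Jordan(7) by auto
  qed
  then have "\<not> connected_component (- (K \<union> path_image g)) z w"
    by (metis Compl_anti_mono K_Un_loop Un_upper2 connected_component_of_subset)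
  moreover have "connected_component (- K) z w"
    unfolding connected_component_def using r z w by (intro exI[of _ "ball m r"]) auto
  moreover have "z \<notin> K \<union> path_image g" "w \<notin> K \<union> path_image g"
    using zw z w r unfolding loop_eq by auto
  ultimately show thesis using that z w by blast
qed

end

text \<open>Each of the finitely many pieces is path connected, so it lies inside the path component
  of \<open>p\<close> or misses it; the pieces of either kind have a compact union.\<close>

lemma compact_split_path_components:
  fixes p q :: "'a::t2_space"
  assumes "finite \<F>" and F: "\<And>S. S \<in> \<F> \<Longrightarrow> compact S \<and> path_connected S"
    and pq: "p \<in> \<Union>\<F>" "q \<in> \<Union>\<F>" "\<not> path_component (\<Union>\<F>) p q"
  obtains K\<^sub>1 K\<^sub>2 where "compact K\<^sub>1" "compact K\<^sub>2" "K\<^sub>1 \<inter> K\<^sub>2 = {}" "K\<^sub>1 \<union> K\<^sub>2 = \<Union>\<F>" "p \<in> K\<^sub>1" "q \<in> K\<^sub>2"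
proof
  let ?C = "path_component_set (\<Union>\<F>) p"
  let ?\<F>1 = "{S \<in> \<F>. S \<subseteq> ?C}" and ?\<F>2 = "{S \<in> \<F>. S \<inter> ?C = {}}"
  have dich: "S \<subseteq> ?C" if "S \<in> \<F>" "S \<inter> ?C \<noteq> {}" for S
  proof
    fix y assume "y \<in> S"
    from that obtain x where "x \<in> S" "path_component (\<Union>\<F>) p x" by auto
    moreover have "path_component (\<Union>\<F>) x y"
      using F[OF that(1)] \<open>x \<in> S\<close> \<open>y \<in> S\<close> that(1) path_component_of_subset[of S "\<Union>\<F>"]
      by (auto simp: path_connected_component)
    ultimately show "y \<in> ?C" using path_component_trans by auto
  qed
  show "compact (\<Union>?\<F>1)" "compact (\<Union>?\<F>2)"
    using assms(1) F by (auto intro!: compact_Union)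
  show "\<Union>?\<F>1 \<inter> \<Union>?\<F>2 = {}" by blast
  show un: "\<Union>?\<F>1 \<union> \<Union>?\<F>2 = \<Union>\<F>" using dich by blast
  have "p \<in> ?C" using pq(1) by (simp add: path_component_refl_eq)
  then show "p \<in> \<Union>?\<F>1" using pq(1) un by blast
  have "q \<notin> ?C" using pq(3) by simp
  then show "q \<in> \<Union>?\<F>2" using pq(2) un by blast
qed

subsection \<open>Plane graphs\<close>

text \<open>The index type is free so that curves can later be labelled by pairs of an edge and an
  endpoint, or by a disjoint sum. Parallel edges are allowed; loops are not, as an arc has distinct
  ends.\<close>

locale plane_graph =
  fixes P :: "complex set" and I :: "'i set" and g :: "'i \<Rightarrow> real \<Rightarrow> complex"
  assumes finite_P: "finite P" and P_nonempty: "P \<noteq> {}" and finite_I: "finite I"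
    and arc: "i \<in> I \<Longrightarrow> arc (g i)"
    and ends_in: "i \<in> I \<Longrightarrow> pathstart (g i) \<in> P" "i \<in> I \<Longrightarrow> pathfinish (g i) \<in> P"
    and avoid: "i \<in> I \<Longrightarrow> open_arc (g i) \<inter> P = {}"
    and disjoint: "i \<in> I \<Longrightarrow> j \<in> I \<Longrightarrow> i \<noteq> j \<Longrightarrow> open_arc (g i) \<inter> open_arc (g j) = {}"
begin

definition drawn where "drawn J = P \<union> (\<Union>j\<in>J. path_image (g j))"

definition ends where "ends i = {pathstart (g i), pathfinish (g i)}"

text \<open>This is minimum degree at least two on the endpoints of \<open>C\<close>. A finite graph
  is a forest exactly if none of its edge sets is a core, so cores stand in for cycles and no cycle
  has to be traced.\<close>

definition core where
  "core C \<longleftrightarrow> C \<noteq> {} \<and> (\<forall>i\<in>C. \<forall>v\<in>ends i. \<exists>j\<in>C. j \<noteq> i \<and> v \<in> ends j)"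

lemma ends_subset: "i \<in> I \<Longrightarrow> ends i \<subseteq> P"
  using ends_in unfolding ends_def by auto

lemma path_image_eq: "path_image (g i) = open_arc (g i) \<union> ends i"
  unfolding ends_def by (rule path_image_open_arc)

lemma drawn_eq: "J \<subseteq> I \<Longrightarrow> drawn J = P \<union> (\<Union>j\<in>J. open_arc (g j))"
  unfolding drawn_def path_image_eq using ends_subset by blast

lemma drawn_insert: "drawn (insert i J) = drawn J \<union> path_image (g i)"
  unfolding drawn_def by auto

lemma drawn_mono: "J \<subseteq> J' \<Longrightarrow> drawn J \<subseteq> drawn J'"
  unfolding drawn_def by auto

lemma open_arc_drawn: "J \<subseteq> I \<Longrightarrow> i \<in> I \<Longrightarrow> i \<notin> J \<Longrightarrow> open_arc (g i) \<inter> drawn J = {}"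
  unfolding drawn_eq using avoid disjoint by blast

lemma compact_path_image: "i \<in> I \<Longrightarrow> compact (path_image (g i))"
  using arc compact_arc_image by blast

lemma compact_drawn: "J \<subseteq> I \<Longrightarrow> compact (drawn J)"
  unfolding drawn_def using finite_subset[OF _ finite_I] compact_path_image
  by (intro compact_Un finite_imp_compact[OF finite_P] compact_UN) auto

lemma closed_drawn: "J \<subseteq> I \<Longrightarrow> closed (drawn J)"
  using compact_drawn compact_imp_closed by blast

lemma interior_drawn_empty:
  assumes "J \<subseteq> I" shows "interior (drawn J) = {}"
proof -
  have "finite J" using assms finite_I finite_subset by blast
  then show ?thesis using assms
  proof (induction J)
    case empty
    then show ?case using finite_P by (simp add: drawn_def empty_interior_finite)
  next
    case (insert i J)
    then show ?case
      using interior_closed_Un_empty_interior[OF closed_drawn[of J] interior_arc_image_empty[OF arc[of i]]]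
      by (simp add: drawn_insert)
  qed
qed

text \<open>Either the ends of the new edge are already joined in the drawing, and an arc between
  them completes a Jordan curve, or the drawing splits into two disjoint compact parts that the edge
  links.\<close>

lemma insert_edge_cases:
  assumes "J \<subseteq> I" "i \<in> I" "i \<notin> J"
  obtains (close) d where "closing_arc (drawn J) (g i) d"
      "path_component (drawn J) (pathstart (g i)) (pathfinish (g i))"
  | (link) "\<not> path_component (drawn J) (pathstart (g i)) (pathfinish (g i))"
    "\<And>a b. connected_component (- drawn J) a b \<Longrightarrow> a \<notin> path_image (g i) \<Longrightarrow> b \<notin> path_image (g i) \<Longrightarrow>
       connected_component (- drawn (insert i J)) a b"
proof (cases "path_component (drawn J) (pathstart (g i)) (pathfinish (g i))")
  case True
  then have "path_component (drawn J) (pathfinish (g i)) (pathstart (g i))"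
    by (rule path_component_sym)
  then obtain h where h: "path h" "path_image h \<subseteq> drawn J"
      "pathstart h = pathfinish (g i)" "pathfinish h = pathstart (g i)"
    unfolding path_component_def by auto
  then obtain d where "arc d" "path_image d \<subseteq> path_image h"
      "pathstart d = pathfinish (g i)" "pathfinish d = pathstart (g i)"
    using path_contains_arc[of h "pathfinish (g i)" "pathstart (g i)"] arc_distinct_ends[OF arc[OF assms(2)]]
    by metis
  then have "closing_arc (drawn J) (g i) d"
    using h open_arc_drawn[OF assms] closed_drawn[OF assms(1)] arc[OF assms(2)]
    by unfold_locales auto
  then show thesis using close True by blast
next
  case False
  define \<F> where "\<F> = (\<lambda>v. {v}) ` P \<union> (\<lambda>j. path_image (g j)) ` J"
  have UF: "\<Union>\<F> = drawn J" unfolding \<F>_def drawn_def by auto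
  have "finite \<F>" unfolding \<F>_def using finite_P finite_I assms(1) finite_subset by blast
  moreover have "compact S \<and> path_connected S" if "S \<in> \<F>" for S
    using that assms(1) compact_path_image arc arc_imp_path unfolding \<F>_def
    by (auto intro!: path_connected_path_image)
  moreover have "pathstart (g i) \<in> drawn J" "pathfinish (g i) \<in> drawn J"
    using ends_in assms(2) unfolding drawn_def by auto
  ultimately obtain K\<^sub>1 K\<^sub>2 where K: "compact K\<^sub>1" "compact K\<^sub>2" "K\<^sub>1 \<inter> K\<^sub>2 = {}" "K\<^sub>1 \<union> K\<^sub>2 = drawn J"
      "pathstart (g i) \<in> K\<^sub>1" "pathfinish (g i) \<in> K\<^sub>2"
    using compact_split_path_components[of \<F>] False unfolding UF by metis
  have "path_image (g i) \<inter> K\<^sub>1 \<subseteq> {pathstart (g i)}" "path_image (g i) \<inter> K\<^sub>2 \<subseteq> {pathfinish (g i)}"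
    using K(3-6) open_arc_drawn[OF assms] unfolding path_image_open_arc by blast+
  then show thesis
    using connected_component_add_linking_arc[OF K(1-3) arc[OF assms(2)]] False link
    unfolding K(4) drawn_insert by blast
qed

lemma edge_two_sides:
  assumes J: "J \<subseteq> I" "i \<in> I" "i \<notin> J"
    and ab: "connected_component (- drawn J) a b" "connected_component (- drawn J) b c"
    and nin: "a \<notin> path_image (g i)" "b \<notin> path_image (g i)" "c \<notin> path_image (g i)"
  shows "connected_component (- drawn (insert i J)) a b \<or>
    connected_component (- drawn (insert i J)) b c \<or>
    connected_component (- drawn (insert i J)) a c"
  using J
proof (cases rule: insert_edge_cases)
  case (close d)
  then show ?thesis using closing_arc.at_most_two_sides[OF close(1) ab nin] by (simp add: drawn_insert)
next
  case link
  then show ?thesis using ab nin by blast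
qed

section \<open>Euler's inequality\<close>

definition scattered where
  "scattered A J \<longleftrightarrow> finite A \<and> A \<inter> drawn I = {} \<and>
     (\<forall>a\<in>A. \<forall>b\<in>A. connected_component (- drawn J) a b \<longrightarrow> a = b)"

text \<open>The witness \<^term>\<open>A\<close> samples the faces, and \<^term>\<open>R\<close> meets every component of the graph; keeping \<^term>\<open>A\<close>
  off the whole drawing means that no point has to be moved when an edge is added.\<close>
lemma euler_inequality_aux:
  assumes "J \<subseteq> I"
  shows "\<exists>A R. scattered A J \<and> R \<subseteq> P \<and> (\<forall>v\<in>P. \<exists>r\<in>R. path_component (drawn J) r v) \<and>
    card A + card P \<ge> card J + 1 + card R"
proof -
  have "finite J" using assms finite_I finite_subset by blast
  then show ?thesis using assms
  proof (induction J)
    case empty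
    \<comment> \<open>In the empty graph one point samples the only face and every vertex represents
      itself, so equality holds.\<close>
    have "drawn I \<noteq> UNIV" using compact_drawn[of I] not_compact_UNIV by auto
    then obtain a where "a \<notin> drawn I" by auto
    then have "scattered {a} {}" unfolding scattered_def by auto
    moreover have "\<forall>v\<in>P. \<exists>r\<in>P. path_component (drawn {}) r v"
      by (auto simp: drawn_def intro!: bexI path_component_refl)
    ultimately show ?case by (intro exI[of _ "{a}"] exI[of _ P]) auto
  next
    case (insert i J)
    then have J: "J \<subseteq> I" "i \<in> I" "i \<notin> J" by auto
    from insert obtain A R where A: "scattered A J" and R: "R \<subseteq> P"
        "\<forall>v\<in>P. \<exists>r\<in>R. path_component (drawn J) r v"
      and card: "card A + card P \<ge> card J + 1 + card R" by auto
    have finR: "finite R" using R finite_P finite_subset by blast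
    have mono: "connected_component (- drawn J) a b" if "connected_component (- drawn (insert i J)) a b" for a b
      using that drawn_mono[of J "insert i J"] connected_component_of_subset by (metis Compl_anti_mono subset_insertI)
    have pmono: "path_component (drawn (insert i J)) a b" if "path_component (drawn J) a b" for a b
      using that drawn_mono[of J "insert i J"] path_component_of_subset by (metis subset_insertI)
    have A': "scattered A (insert i J)" using A mono unfolding scattered_def by blast
    show ?case using J
    proof (cases rule: insert_edge_cases)
      case (close d)
      interpret closing_arc "drawn J" "g i" d by fact
      obtain z w where zw: "z \<notin> drawn I" "w \<notin> drawn I" "connected_component (- drawn J) z w"
          "\<not> connected_component (- drawn (insert i J)) z w"
        using separates[OF interior_drawn_empty[OF order_refl] closed_drawn[OF order_refl]]
        unfolding drawn_insert by metis
      \<comment> \<open>If the faces of \<open>z\<close> and \<open>w\<close> were both sampled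
        already, the two samples would lie in one face before the insertion, hence coincide, and
        would join \<open>z\<close> to \<open>w\<close>. So one of the two points is a new
        sample.\<close>
      have "\<exists>y\<in>{z,w}. \<forall>a\<in>A. \<not> connected_component (- drawn (insert i J)) y a"
      proof (rule ccontr)
        assume "\<not> ?thesis"
        then obtain a b where ab: "a \<in> A" "b \<in> A" "connected_component (- drawn (insert i J)) z a"
            "connected_component (- drawn (insert i J)) w b" by auto
        then have "connected_component (- drawn J) a b"
          using zw(3) mono by (meson connected_component_sym connected_component_trans)
        then have "a = b" using A ab unfolding scattered_def by auto
        then show False using ab zw(4) by (meson connected_component_sym connected_component_trans)
      qed
      then obtain y where y: "y \<in> {z,w}" "\<And>a. a \<in> A \<Longrightarrow> \<not> connected_component (- drawn (insert i J)) y a"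
        by auto
      have "drawn (insert i J) \<subseteq> drawn I" using drawn_mono[OF insert.prems] .
      then have "y \<notin> drawn (insert i J)" using y zw by auto
      then have "y \<notin> A" using y(2)[of y] by (auto simp: connected_component_refl_eq)
      have "scattered (insert y A) (insert i J)"
        using A' y zw unfolding scattered_def by (auto dest: connected_component_sym)
      moreover have "card (insert y A) + card P \<ge> card (insert i J) + 1 + card R"
        using card \<open>y \<notin> A\<close> A insert.hyps unfolding scattered_def by simp
      moreover have "\<forall>v\<in>P. \<exists>r\<in>R. path_component (drawn (insert i J)) r v" using R(2) pmono by blast
      ultimately show ?thesis using R(1) by blast
    next
      case link
      let ?p = "pathstart (g i)" and ?q = "pathfinish (g i)"
      obtain r s where rs: "r \<in> R" "path_component (drawn J) r ?p" "s \<in> R" "path_component (drawn J) s ?q"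
        using R(2) ends_in J(2) by blast
      then have "r \<noteq> s" using link(1) by (metis path_component_sym path_component_trans)
      have "path_component (path_image (g i)) ?p ?q"
        using arc[OF J(2)] arc_imp_path unfolding path_component_def by blast
      then have "path_component (drawn (insert i J)) ?p ?q"
        using path_component_of_subset by (metis drawn_insert sup_ge2)
      then have rs': "path_component (drawn (insert i J)) r s"
        using pmono[OF rs(2)] pmono[OF rs(4)] by (meson path_component_sym path_component_trans)
      have "\<exists>r\<in>R - {s}. path_component (drawn (insert i J)) r v" if v: "v \<in> P" for v
      proof -
        obtain t where t: "t \<in> R" "path_component (drawn J) t v" using R v by blast
        show ?thesis
        proof (cases "t = s")
          case True
          then have "path_component (drawn (insert i J)) r v"
            using rs' pmono[OF t(2)] path_component_trans by metis
          then show ?thesis using rs \<open>r \<noteq> s\<close> by blast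
        qed (use t pmono in blast)
      qed
      moreover have "card R = Suc (card (R - {s}))" using rs(3) finR by (metis card.remove)
      then have "card A + card P \<ge> card (insert i J) + 1 + card (R - {s})"
        using card insert.hyps by simp
      ultimately show ?thesis using A' R by blast
    qed
  qed
qed

text \<open>As \<open>P\<close> is nonempty, at least one component is represented, so
  \<open>card R\<close> contributes at least 1.\<close>

lemma euler_inequality:
  obtains A where "scattered A I" "card A + card P \<ge> card I + 2"
proof -
  obtain A R where A: "scattered A I" and R: "R \<subseteq> P" "\<forall>v\<in>P. \<exists>r\<in>R. path_component (drawn I) r v"
    and c: "card A + card P \<ge> card I + 1 + card R"
    using euler_inequality_aux[of I] by auto
  have "R \<noteq> {}" using R P_nonempty by auto
  moreover have "finite R" using R(1) finite_P finite_subset by blast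
  ultimately have "card R \<ge> 1" by (simp add: Suc_leI card_gt_0_iff)
  then show thesis using that A c by auto
qed

section \<open>Forests do not separate the plane\<close>

lemma connected_component_add_points:
  assumes "finite Q" "closed K" "connected_component (- K) a b" "a \<notin> Q" "b \<notin> Q"
  shows "connected_component (- (Q \<union> K :: complex set)) a b"
  using assms
proof (induction Q)
  case (insert v Q)
  have "connected_component (- {v}) a b"
    using insert.prems connected_punctured_universe[of v]
    by (auto simp: connected_iff_connected_component)
  then have "connected_component (- ({v} \<union> (Q \<union> K))) a b"
    using insert
    by (intro Janiszewski_subsingleton[of "{v}" "Q \<union> K" v]) (auto intro: closed_Un finite_imp_closed)
  then show ?case by simp
qed simp

text \<open>Without a core some edge \<open>i\<close> has an end \<open>v\<close> on no other edge.
  Its arc meets the other arcs in at most its other end \<open>u\<close>, so Janiszewski's theorem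
  adds it to the smaller set given by induction. The points of \<open>P\<close> are added
  last.\<close>

lemma acyclic_not_separating:
  assumes "C \<subseteq> I" and "\<And>D. D \<subseteq> C \<Longrightarrow> \<not> core D" and "a \<notin> drawn C" "b \<notin> drawn C"
  shows "connected_component (- drawn C) a b"
proof -
  let ?U = "\<lambda>C. \<Union>i\<in>C. path_image (g i)"
  have "finite C" using assms finite_I finite_subset by blast
  then have "connected_component (- ?U C) a b" using assms
  proof (induction C rule: finite_psubset_induct)
    case (psubset C)
    show ?case
    proof (cases "C = {}")
      case True
      then show ?thesis unfolding connected_component_def by (intro exI[of _ UNIV]) auto
    next
      case False
      then obtain i v where i: "i \<in> C" "v \<in> ends i" "\<And>j. j \<in> C \<Longrightarrow> j \<noteq> i \<Longrightarrow> v \<notin> ends j"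
        using psubset.prems(2)[of C] unfolding core_def by blast
      let ?D = "C - {i}"
      obtain u where u: "ends i = {u, v}" using i(2) unfolding ends_def by blast
      have iI: "i \<in> I" and DI: "?D \<subseteq> I" using i psubset.prems by auto
      have "v \<notin> ?U ?D"
      proof
        assume "v \<in> ?U ?D"
        then obtain j where j: "j \<in> C" "j \<noteq> i" "v \<in> path_image (g j)" by auto
        then have "v \<in> open_arc (g j)" using i(3) unfolding path_image_eq by auto
        moreover have "v \<in> P" using i ends_subset[OF iI] by auto
        ultimately show False using avoid[of j] j psubset.prems(1) by auto
      qed
      moreover have "?U ?D \<subseteq> drawn ?D" unfolding drawn_def by auto
      then have "open_arc (g i) \<inter> ?U ?D = {}" using open_arc_drawn[OF DI iI] by blast
      ultimately have "path_image (g i) \<inter> ?U ?D \<subseteq> {u}" unfolding path_image_eq u by auto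
      moreover have "connected_component (- path_image (g i)) a b"
        using connected_component_arc_complement[OF arc[OF iI]] psubset.prems(3,4) i(1)
        unfolding drawn_def by auto
      moreover have "connected_component (- ?U ?D) a b"
      proof (rule psubset.IH)
        show "?D \<subset> C" "?D \<subseteq> I" using i(1) DI by auto
        show "\<not> core D" if "D \<subseteq> ?D" for D using that psubset.prems(2)[of D] by auto
        show "a \<notin> drawn ?D" "b \<notin> drawn ?D" using psubset.prems(3,4) drawn_mono[of ?D C] by auto
      qed
      moreover have "closed (?U ?D)"
        using psubset.hyps DI compact_path_image by (intro closed_UN) (auto intro: compact_imp_closed)
      ultimately have "connected_component (- (path_image (g i) \<union> ?U ?D)) a b"
        using compact_path_image[OF iI] by (intro Janiszewski_subsingleton) auto
      moreover have "path_image (g i) \<union> ?U ?D = ?U C" using i(1) by auto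
      ultimately show ?thesis by simp
    qed
  qed
  moreover have "closed (?U C)"
    using \<open>finite C\<close> assms(1) compact_path_image by (intro closed_UN) (auto intro: compact_imp_closed)
  ultimately show ?thesis
    using connected_component_add_points[OF finite_P] assms(3,4) unfolding drawn_def by blast
qed

section \<open>Faces and their boundary edges\<close>

definition face where "face a = connected_component_set (- drawn I) a"

definition boundary where "boundary a = {i \<in> I. closure (face a) \<inter> open_arc (g i) \<noteq> {}}"

text \<open>Otherwise the boundary edges form a forest and leave \<open>a\<close> and
  \<open>b\<close> connected. A connected set witnessing this meets the frontier of the face of
  \<open>a\<close>, yet that frontier lies in the drawing of the boundary edges.\<close>

lemma boundary_contains_core:
  assumes "a \<notin> drawn I" "b \<notin> drawn I" "\<not> connected_component (- drawn I) a b"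
  obtains C where "C \<subseteq> boundary a" "core C"
proof (rule ccontr)
  assume no: "\<not> thesis"
  let ?B = "boundary a"
  have BI: "?B \<subseteq> I" unfolding boundary_def by auto
  then have sub: "drawn ?B \<subseteq> drawn I" by (rule drawn_mono)
  have "connected_component (- drawn ?B) a b"
    using no that assms sub BI by (intro acyclic_not_separating) auto
  then obtain T where T: "connected T" "T \<subseteq> - drawn ?B" "a \<in> T" "b \<in> T"
    unfolding connected_component_def by auto
  have "a \<in> face a" "b \<notin> face a"
    using assms unfolding face_def by (auto simp: connected_component_refl_eq)
  then have "T \<inter> frontier (face a) \<noteq> {}" using T by (intro connected_Int_frontier) auto
  moreover have "frontier (face a) \<subseteq> drawn ?B"
  proof
    fix x assume x: "x \<in> frontier (face a)"
    then have "x \<in> frontier (- drawn I)"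
      unfolding face_def using frontier_of_connected_component_subset by blast
    then have "x \<in> drawn I"
      using closed_drawn[OF order_refl] frontier_subset_closed by (auto simp: frontier_complement)
    then have "x \<in> P \<or> (\<exists>i\<in>I. x \<in> open_arc (g i))" using drawn_eq[of I] by auto
    moreover have "x \<in> closure (face a)" using x by (simp add: frontier_def)
    ultimately have "x \<in> P \<or> (\<exists>i\<in>?B. x \<in> open_arc (g i))" unfolding boundary_def by auto
    then show "x \<in> drawn ?B" using drawn_eq[OF BI] by auto
  qed
  ultimately show False using T(2) by auto
qed

text \<open>The face of \<open>a\<close> comes arbitrarily close to some point of the open arc of
  \<open>i\<close>. Once \<open>i\<close> is deleted, a small ball there joins the face to the arc,
  whose midpoint is a common target for all faces at \<open>i\<close>.\<close>

lemma boundary_connected: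
  assumes "i \<in> boundary a"
  shows "connected_component (- drawn (I - {i})) a (g i (1/2))"
proof -
  have i: "i \<in> I" using assms unfolding boundary_def by auto
  have disj: "open_arc (g i) \<inter> drawn (I - {i}) = {}" using i by (intro open_arc_drawn) auto
  obtain m where m: "m \<in> closure (face a)" "m \<in> open_arc (g i)" using assms unfolding boundary_def by auto
  have "open (- drawn (I - {i}))" "m \<in> - drawn (I - {i})"
    using closed_drawn[of "I - {i}"] disj m(2) by auto
  then obtain r where r: "r > 0" "ball m r \<subseteq> - drawn (I - {i})" using open_contains_ball by metis
  obtain y where y: "y \<in> face a" "y \<in> ball m r"
    using m(1) r(1) by (metis closure_approachable mem_ball dist_commute)
  have 1: "connected_component (- drawn (I - {i})) a y"
    using y(1) connected_component_of_subset[of "- drawn I"] drawn_mono[of "I - {i}" I]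
    unfolding face_def by auto
  have 2: "connected_component (- drawn (I - {i})) y m"
    unfolding connected_component_def using r y by (intro exI[of _ "ball m r"]) auto
  have "g i (1/2) \<in> open_arc (g i)" unfolding open_arc_def by auto
  then have 3: "connected_component (- drawn (I - {i})) m (g i (1/2))"
    using connected_open_arc[OF arc_imp_path[OF arc[OF i]]] m(2) disj
    unfolding connected_component_def by blast
  show ?thesis using 1 2 3 connected_component_trans by metis
qed

text \<open>Three faces at \<open>i\<close> would merge into one when \<open>i\<close> is deleted,
  while by \<open>edge_two_sides\<close> putting \<open>i\<close> back splits a face into at most
  two.\<close>

lemma card_faces_at_edge:
  assumes "scattered A I" "i \<in> I"
  shows "card {a\<in>A. i \<in> boundary a} \<le> 2"
proof (rule ccontr)
  assume "\<not> ?thesis"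
  then have "3 \<le> card {a\<in>A. i \<in> boundary a}" by simp
  then obtain S where "S \<subseteq> {a\<in>A. i \<in> boundary a}" "card S = 3" by (meson obtain_subset_with_card_n)
  then obtain a b c where abc: "a \<noteq> b" "b \<noteq> c" "a \<noteq> c" "{a,b,c} \<subseteq> {a\<in>A. i \<in> boundary a}"
    by (auto simp: card_3_iff)
  have "connected_component (- drawn (I - {i})) a b" "connected_component (- drawn (I - {i})) b c"
    using boundary_connected[of i] abc(4)
    by (metis (mono_tags, lifting) connected_component_sym connected_component_trans insert_subset mem_Collect_eq)+
  moreover have "path_image (g i) \<subseteq> drawn I" using assms(2) unfolding drawn_def by auto
  then have "a \<notin> path_image (g i)" "b \<notin> path_image (g i)" "c \<notin> path_image (g i)"
    using assms(1) abc(4) unfolding scattered_def by auto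
  moreover have "insert i (I - {i}) = I" using assms(2) by auto
  ultimately have "connected_component (- drawn I) a b \<or> connected_component (- drawn I) b c
      \<or> connected_component (- drawn I) a c"
    using edge_two_sides[of "I - {i}" i a b c] assms(2) by auto
  then show False using assms(1) abc unfolding scattered_def by blast
qed

text \<open>With at least two face samples, each has at least \<open>k\<close> boundary edges in
  \<open>W\<close>, and each edge serves at most two samples; Euler's inequality does the rest. With
  at most one sample it gives the first alternative, the edge bound for forests.\<close>

lemma weighted_girth_bound:
  assumes "W \<subseteq> I" and girth: "\<And>C. C \<subseteq> I \<Longrightarrow> core C \<Longrightarrow> k \<le> card (C \<inter> W)"
  shows "card I + 1 \<le> card P \<or> k * (card I + 2) \<le> 2 * card W + k * card P"
proof -
  obtain A where A: "scattered A I" "card A + card P \<ge> card I + 2" by (rule euler_inequality)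
  have finA: "finite A" and finW: "finite W"
    using A assms(1) finite_I finite_subset unfolding scattered_def by auto
  show ?thesis
  proof (cases "card A \<le> 1")
    case True
    then show ?thesis using A by auto
  next
    case False
    have k: "k \<le> card {i\<in>W. i \<in> boundary a}" if a: "a \<in> A" for a
    proof -
      have "\<not> A \<subseteq> {a}" using False card_mono[of "{a}" A] by auto
      then obtain b where "b \<in> A" "b \<noteq> a" by auto
      then obtain C where C: "C \<subseteq> boundary a" "core C"
        using boundary_contains_core[of a b] A(1) a unfolding scattered_def by blast
      then have "k \<le> card (C \<inter> W)" using girth[of C] unfolding boundary_def by auto
      also have "\<dots> \<le> card {i\<in>W. i \<in> boundary a}" using C finW by (intro card_mono) auto
      finally show ?thesis .
    qed
    have "k * card A = (\<Sum>a\<in>A. k)" by simp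
    also have "\<dots> \<le> (\<Sum>a\<in>A. card {i\<in>W. i \<in> boundary a})" using k by (intro sum_mono) auto
    also have "\<dots> = (\<Sum>i\<in>W. card {a\<in>A. i \<in> boundary a})"
      using finA finW by (rule sum_multicount_gen) auto
    also have "\<dots> \<le> (\<Sum>i\<in>W. 2)" using card_faces_at_edge[OF A(1)] assms(1) by (intro sum_mono) auto
    finally have "k * card A \<le> 2 * card W" by simp
    moreover have "k * (card I + 2) \<le> k * card A + k * card P"
      using A(2) by (metis add_mult_distrib2 mult_le_mono2)
    ultimately show ?thesis by linarith
  qed
qed

end

subsection \<open>One-planar drawings\<close>

text \<open>An edge \<open>uv\<close> is prolonged at its ends to \<open>u'\<close> and
  \<open>v'\<close>, which differ because there is no triangle, and once more from \<open>u'\<close>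
  to \<open>w\<close>. The four edges are distinct even if \<open>w\<close> equals
  \<open>v'\<close>.\<close>

lemma triangle_free_min_degree_2:
  assumes E: "\<And>e. e \<in> C \<Longrightarrow> card e = 2" and "triangle_free C" "C \<noteq> {}" "finite C"
    and deg: "\<And>e u. e \<in> C \<Longrightarrow> u \<in> e \<Longrightarrow> \<exists>f\<in>C. f \<noteq> e \<and> u \<in> f"
  shows "4 \<le> card C"
proof -
  have other: "\<exists>w. f = {u, w} \<and> w \<noteq> u" if "f \<in> C" "u \<in> f" for f u
    using E[OF that(1)] that(2) by (auto simp: card_2_iff)
  obtain e u where "e \<in> C" "u \<in> e" using assms(3) E by (metis card.empty equals0I zero_neq_numeral)
  then obtain v where e: "{u, v} \<in> C" "u \<noteq> v" using other by metis
  have step: "\<exists>w. {y, w} \<in> C \<and> w \<noteq> x \<and> w \<noteq> y" if "{x, y} \<in> C" for x y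
  proof -
    obtain f where f: "f \<in> C" "f \<noteq> {x, y}" "y \<in> f" using deg \<open>{x, y} \<in> C\<close> by blast
    then obtain w where "f = {y, w}" "w \<noteq> y" using other by blast
    then show ?thesis using f by (auto simp: insert_commute)
  qed
  have "{v, u} \<in> C" using e(1) by (simp add: insert_commute)
  then obtain u' where u': "{u, u'} \<in> C" "u' \<noteq> v" "u' \<noteq> u" using step by blast
  obtain v' where v': "{v, v'} \<in> C" "v' \<noteq> u" "v' \<noteq> v" using step[OF e(1)] by blast
  obtain w where w: "{u', w} \<in> C" "w \<noteq> u" "w \<noteq> u'" using step[OF u'(1)] by blast
  have "u' \<noteq> v'"
  proof
    assume "u' = v'"
    then have "u \<noteq> v \<and> v \<noteq> u' \<and> u \<noteq> u' \<and> {u, v} \<in> C \<and> {v, u'} \<in> C \<and> {u, u'} \<in> C"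
      using e u' v' by simp
    then show False using assms(2) unfolding triangle_free_def by metis
  qed
  then have "card {{u, v}, {u, u'}, {v, v'}, {u', w}} = 4"
    using e u' v' w by (auto simp: card_insert_if doubleton_eq_iff)
  moreover have "{{u, v}, {u, u'}, {v, v'}, {u', w}} \<subseteq> C" using e u' v' w by auto
  ultimately show ?thesis using assms(4) card_mono by metis
qed

lemma open_arc_subpath:
  assumes "u < v" shows "open_arc (subpath u v g) = g ` {u<..<v}"
proof -
  have "(\<lambda>x. (v - u) * x + u) ` {0<..<1} = {u<..<v}"
  proof (intro equalityI subsetI)
    fix y assume "y \<in> {u<..<v}"
    then have "y = (v - u) * ((y - u) / (v - u)) + u" "(y - u) / (v - u) \<in> {0<..<1}"
      using assms by (auto simp: field_simps)
    then show "y \<in> (\<lambda>x. (v - u) * x + u) ` {0<..<1}" by (rule image_eqI)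
  next
    fix y assume "y \<in> (\<lambda>x. (v - u) * x + u) ` {0<..<1}"
    then obtain x where x: "y = (v - u) * x + u" "x \<in> {0<..<1}" by (rule imageE)
    then have "(v - u) * x < (v - u) * 1" using assms by (intro mult_strict_left_mono) auto
    moreover have "0 < (v - u) * x" using x assms by simp
    ultimately show "y \<in> {u<..<v}" using x by auto
  qed
  then show ?thesis unfolding open_arc_def subpath_def by (metis image_image)
qed

locale one_planar =
  fixes V :: "'a set" and E :: "'a set set" and pos :: "'a \<Rightarrow> complex"
    and \<gamma> :: "'a set \<Rightarrow> real \<Rightarrow> complex"
  assumes finite_V: "finite V" and V_nonempty: "V \<noteq> {}"
    and edge: "e \<in> E \<Longrightarrow> e \<subseteq> V" "e \<in> E \<Longrightarrow> card e = 2"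
    and inj_pos: "inj_on pos V"
    and arc: "e \<in> E \<Longrightarrow> arc (\<gamma> e)"
    and ends: "e \<in> E \<Longrightarrow> {pathstart (\<gamma> e), pathfinish (\<gamma> e)} = pos ` e"
    and avoid: "e \<in> E \<Longrightarrow> open_arc (\<gamma> e) \<inter> pos ` V = {}"
    and single: "\<lbrakk>e \<in> E; f \<in> E; f' \<in> E; f \<noteq> e; f' \<noteq> e; p \<in> open_arc (\<gamma> e); p \<in> open_arc (\<gamma> f);
      p' \<in> open_arc (\<gamma> e); p' \<in> open_arc (\<gamma> f')\<rbrakk> \<Longrightarrow> f = f' \<and> p = p'"
begin

section \<open>Pairs of crossing edges\<close>

definition crossed where
  "crossed = {e \<in> E. \<exists>f\<in>E. f \<noteq> e \<and> open_arc (\<gamma> e) \<inter> open_arc (\<gamma> f) \<noteq> {}}"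

text \<open>By \<open>single\<close> the choice is forced on \<open>crossed\<close>: crossing pairs
  up the edges, and each pair has one crossing point.\<close>

definition partner where
  "partner e = (SOME f. f \<in> E \<and> f \<noteq> e \<and> open_arc (\<gamma> e) \<inter> open_arc (\<gamma> f) \<noteq> {})"

definition crossing where
  "crossing e = (SOME p. p \<in> open_arc (\<gamma> e) \<inter> open_arc (\<gamma> (partner e)))"

lemma finite_E: "finite E"
  using finite_V edge(1) by (metis Pow_iff finite_Pow_iff finite_subset subsetI)

lemma crossed_subset: "crossed \<subseteq> E"
  unfolding crossed_def by auto

lemma finite_crossed: "finite crossed"
  using crossed_subset finite_E finite_subset by blast

lemma partner_aux:
  assumes "e \<in> crossed"
  shows "partner e \<in> E" "partner e \<noteq> e" "crossing e \<in> open_arc (\<gamma> e)"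
    "crossing e \<in> open_arc (\<gamma> (partner e))"
proof -
  have "\<exists>f. f \<in> E \<and> f \<noteq> e \<and> open_arc (\<gamma> e) \<inter> open_arc (\<gamma> f) \<noteq> {}"
    using assms unfolding crossed_def by auto
  from someI_ex[OF this, folded partner_def]
  have 1: "partner e \<in> E" "partner e \<noteq> e" "\<exists>p. p \<in> open_arc (\<gamma> e) \<inter> open_arc (\<gamma> (partner e))"
    by auto
  from someI_ex[OF 1(3), folded crossing_def] 1
  show "partner e \<in> E" "partner e \<noteq> e" "crossing e \<in> open_arc (\<gamma> e)"
    "crossing e \<in> open_arc (\<gamma> (partner e))" by auto
qed

lemma crossing_unique:
  assumes "e \<in> E" "f \<in> E" "e \<noteq> f" "p \<in> open_arc (\<gamma> e)" "p \<in> open_arc (\<gamma> f)"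
  shows "e \<in> crossed" "f = partner e" "p = crossing e"
proof -
  show e: "e \<in> crossed" using assms unfolding crossed_def by auto
  show "f = partner e" "p = crossing e"
    using single[of e f "partner e" p "crossing e"] partner_aux[OF e] assms by auto
qed

lemma partner:
  assumes "e \<in> crossed"
  shows "partner e \<in> crossed" "partner (partner e) = e" "crossing (partner e) = crossing e"
  using crossing_unique[of "partner e" e "crossing e"] partner_aux[OF assms] assms crossed_subset
  by auto

lemma crossing_on_edge:
  assumes "e \<in> crossed" "f \<in> E" "crossing e \<in> open_arc (\<gamma> f)"
  shows "f = e \<or> f = partner e"
  using crossing_unique(2)[of e f "crossing e"] assms partner_aux(3) crossed_subset by blast

lemma crossing_eq:
  assumes "e \<in> crossed" "f \<in> crossed" "crossing e = crossing f"
  shows "f = e \<or> f = partner e"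
  using crossing_on_edge[of e f] assms partner_aux crossed_subset by auto

lemma crossing_not_vertex: "e \<in> crossed \<Longrightarrow> crossing e \<notin> pos ` V"
  using avoid partner_aux crossed_subset by blast

text \<open>A transversal: one edge from each pair of crossing edges.\<close>
definition chosen where "chosen = inv_into crossed crossing ` crossing ` crossed"

lemma chosen_subset: "chosen \<subseteq> crossed"
  unfolding chosen_def by (auto intro: inv_into_into)

lemma inj_on_crossing_chosen: "inj_on crossing chosen"
  unfolding chosen_def inj_on_def by (auto simp: f_inv_into_f)

text \<open>At most one edge of a pair is chosen since both have the same crossing point; at least
  one is, since the edge selected for that point must be \<open>e\<close> or its partner.\<close>

lemma partner_chosen:
  assumes "e \<in> crossed" shows "partner e \<in> chosen \<longleftrightarrow> e \<notin> chosen"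
proof
  assume "partner e \<in> chosen"
  then show "e \<notin> chosen"
    using inj_on_crossing_chosen partner(3)[OF assms] partner_aux(2)[OF assms] unfolding inj_on_def by blast
next
  assume e: "e \<notin> chosen"
  let ?f = "inv_into crossed crossing (crossing e)"
  have "?f \<in> chosen" "crossing ?f = crossing e"
    unfolding chosen_def using assms by (auto simp: f_inv_into_f)
  then have "?f = partner e" using crossing_eq[of e ?f] e assms chosen_subset by (metis subsetD)
  then show "partner e \<in> chosen" using \<open>?f \<in> chosen\<close> by metis
qed

section \<open>Cutting edges at their crossings\<close>

text \<open>This is the part of \<open>e\<close> between its endpoint \<open>u\<close> and its
  crossing point, which sits at parameter \<open>t\<close>. Any \<open>u\<close> not at the start of
  \<open>e\<close> is taken to be at its end.\<close>

definition half where
  "half e u = (let t = (SOME t. t \<in> {0<..<1} \<and> \<gamma> e t = crossing e)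
     in if pathstart (\<gamma> e) = pos u then subpath 0 t (\<gamma> e) else subpath t 1 (\<gamma> e))"

lemma half:
  assumes e: "e \<in> crossed" and u: "u \<in> e"
  shows "arc (half e u)" "{pathstart (half e u), pathfinish (half e u)} = {pos u, crossing e}"
    "open_arc (half e u) \<subseteq> open_arc (\<gamma> e) - {crossing e}"
    "v \<in> e \<Longrightarrow> v \<noteq> u \<Longrightarrow> open_arc (half e u) \<inter> open_arc (half e v) = {}"
proof -
  have eE: "e \<in> E" using e crossed_subset by auto
  define t where "t = (SOME t. t \<in> {0<..<1} \<and> \<gamma> e t = crossing e)"
  have "\<exists>t. t \<in> {0<..<1} \<and> \<gamma> e t = crossing e"
    using partner_aux(3)[OF e] unfolding open_arc_def by auto
  from someI_ex[OF this, folded t_def] have t: "0 < t" "t < 1" "\<gamma> e t = crossing e" by auto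
  have half: "half e w = (if pathstart (\<gamma> e) = pos w then subpath 0 t (\<gamma> e) else subpath t 1 (\<gamma> e))" for w
    unfolding half_def t_def Let_def by simp
  have inj: "inj_on (\<gamma> e) {0..1}" using arc[OF eE] unfolding arc_def by auto
  show "arc (half e u)" unfolding half using arc[OF eE] t by (auto intro!: arc_subpath_arc)
  have fin: "pathfinish (\<gamma> e) = pos w" if "w \<in> e" "pathstart (\<gamma> e) \<noteq> pos w" for w
  proof -
    have "pos w \<in> {pathstart (\<gamma> e), pathfinish (\<gamma> e)}" unfolding ends[OF eE] using that by auto
    then show ?thesis using that(2) by auto
  qed
  show "{pathstart (half e u), pathfinish (half e u)} = {pos u, crossing e}"
    using fin[OF u] t unfolding half by (auto simp: pathstart_def pathfinish_def subpath_def)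
  \<comment> \<open>Injectivity of the arc turns disjoint parameter sets into disjoint images, which
    yields both remaining claims.\<close>
  have disj: "\<gamma> e ` A \<inter> \<gamma> e ` B = {}" if "A \<subseteq> {0..1}" "B \<subseteq> {0..1}" "A \<inter> B = {}" for A B
    using inj that by (metis inj_on_image_Int image_empty)
  have "\<gamma> e ` {0<..<t} \<inter> \<gamma> e ` {t} = {}" "\<gamma> e ` {t<..<1} \<inter> \<gamma> e ` {t} = {}"
    using t by (intro disj; auto)+
  moreover have "\<gamma> e ` {0<..<t} \<subseteq> open_arc (\<gamma> e)" "\<gamma> e ` {t<..<1} \<subseteq> open_arc (\<gamma> e)"
    using t unfolding open_arc_def by auto
  ultimately show "open_arc (half e u) \<subseteq> open_arc (\<gamma> e) - {crossing e}"
    unfolding half using t by (simp add: open_arc_subpath subset_Diff_insert del: image_iff)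
  assume v: "v \<in> e" "v \<noteq> u"
  then have "pos u \<noteq> pos v" using inj_pos u edge(1)[OF eE] unfolding inj_on_def by blast
  then have "(pathstart (\<gamma> e) = pos u) \<noteq> (pathstart (\<gamma> e) = pos v)"
    using fin u v by metis
  moreover have "\<gamma> e ` {0<..<t} \<inter> \<gamma> e ` {t<..<1} = {}"
    using t by (intro disj) auto
  ultimately show "open_arc (half e u) \<inter> open_arc (half e v) = {}"
    unfolding half using t by (simp add: open_arc_subpath Int_commute)
qed

text \<open>The only point of the open arc of \<open>e\<close> on another open arc is the crossing,
  and the half edge omits it.\<close>

lemma half_disjoint_edge:
  assumes "e \<in> crossed" "u \<in> e" "f \<in> E" "f \<noteq> e"
  shows "open_arc (half e u) \<inter> open_arc (\<gamma> f) = {}"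
  using half(3)[OF assms(1,2)] crossing_unique(3)[of e f] assms crossed_subset by blast

lemma pos_eq_iff: "u \<in> V \<Longrightarrow> v \<in> V \<Longrightarrow> pos u = pos v \<longleftrightarrow> u = v"
  using inj_pos unfolding inj_on_def by blast

lemma crossing_on_half:
  assumes "e \<in> crossed" "f \<in> crossed" "u \<in> e"
  shows "crossing f \<notin> open_arc (half e u)"
proof
  assume *: "crossing f \<in> open_arc (half e u)"
  then have "crossing f \<in> open_arc (\<gamma> e)" "crossing f \<noteq> crossing e"
    using half(3)[OF assms(1,3)] by auto
  then show False using crossing_on_edge[of f e] partner(3)[OF assms(2)] assms(1,2) crossed_subset by (metis subsetD)
qed

section \<open>Crossings of disjoint edges\<close>

definition proper where "proper = {e \<in> crossed. e \<inter> partner e = {}}"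

lemma proper_subset: "proper \<subseteq> crossed"
  unfolding proper_def by auto

lemma partner_proper: "e \<in> proper \<Longrightarrow> partner e \<in> proper"
  unfolding proper_def using partner by auto

definition n_proper where "n_proper = card (proper \<inter> chosen)"

text \<open>\<open>partner\<close> pairs up the proper edges, and \<open>chosen\<close> takes one
  from each pair, hence one per crossing point.\<close>

lemma card_proper: "card proper = 2 * n_proper" "card (crossing ` proper) = n_proper"
proof -
  let ?T = "proper \<inter> chosen"
  have fin: "finite ?T" using finite_crossed proper_subset finite_subset by blast
  have T: "e \<in> proper \<Longrightarrow> e \<in> ?T \<or> partner e \<in> ?T" for e
    using partner_chosen partner_proper proper_subset by blast
  have "proper \<subseteq> ?T \<union> partner ` ?T"
  proof
    fix e assume "e \<in> proper"
    then have "e = partner (partner e)" "e \<in> ?T \<or> partner e \<in> ?T" using T partner(2) proper_subset by auto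
    then show "e \<in> ?T \<union> partner ` ?T" by blast
  qed
  then have "proper = ?T \<union> partner ` ?T" using partner_proper by blast
  moreover have "?T \<inter> partner ` ?T = {}"
    using partner_chosen proper_subset by blast
  moreover have "inj_on partner ?T"
    using partner(2) proper_subset by (intro inj_on_inverseI[of _ partner]) auto
  ultimately have "card proper = card ?T + card ?T"
    using fin by (metis card_Un_disjoint card_image finite_imageI)
  then show "card proper = 2 * n_proper" unfolding n_proper_def by simp
  have "crossing ` proper = crossing ` ?T"
  proof (intro equalityI subsetI)
    fix p assume "p \<in> crossing ` proper"
    then obtain e where e: "e \<in> proper" "p = crossing e" by auto
    then have "p = crossing (partner e)" using partner(3) proper_subset by auto
    then show "p \<in> crossing ` ?T" using T[OF e(1)] e(2) by blast
  qed auto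
  moreover have "inj_on crossing ?T" using inj_on_crossing_chosen inj_on_subset by blast
  ultimately show "card (crossing ` proper) = n_proper" unfolding n_proper_def by (simp add: card_image)
qed

text \<open>Cutting both edges of a proper pair makes their crossing the centre of a star with four
  half edges, indexed by edge and endpoint.\<close>

lemma star_graph:
  "plane_graph (pos ` V \<union> crossing ` proper) (SIGMA e:proper. e) (\<lambda>(e, u). half e u)"
proof
  show "finite (pos ` V \<union> crossing ` proper)"
    using finite_V finite_crossed proper_subset finite_subset by blast
  show "pos ` V \<union> crossing ` proper \<noteq> {}" using V_nonempty by auto
  have "finite e" if "e \<in> proper" for e
    using that proper_subset crossed_subset edge(2) by (metis card.infinite subsetD zero_neq_numeral)
  then show "finite (SIGMA e:proper. e)"
    using finite_crossed proper_subset finite_subset by blast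
next
  fix i assume "i \<in> (SIGMA e:proper. e)"
  then obtain e u where i: "i = (e, u)" "e \<in> proper" "u \<in> e" by auto
  then have e: "e \<in> crossed" "e \<in> E" using proper_subset crossed_subset by auto
  note h = half[OF e(1) i(3)]
  show "arc (case i of (e, u) \<Rightarrow> half e u)" using h i by simp
  have "{pathstart (half e u), pathfinish (half e u)} \<subseteq> pos ` V \<union> crossing ` proper"
    unfolding h(2) using i e edge(1) by blast
  then show "pathstart (case i of (e, u) \<Rightarrow> half e u) \<in> pos ` V \<union> crossing ` proper"
    "pathfinish (case i of (e, u) \<Rightarrow> half e u) \<in> pos ` V \<union> crossing ` proper"
    using i(1) by auto
  have "open_arc (half e u) \<inter> pos ` V = {}" using h(3) avoid[OF e(2)] by blast
  then show "open_arc (case i of (e, u) \<Rightarrow> half e u) \<inter> (pos ` V \<union> crossing ` proper) = {}"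
    using crossing_on_half[OF e(1) _ i(3)] proper_subset i(1) by auto
  fix j assume "j \<in> (SIGMA e:proper. e)" "i \<noteq> j"
  then obtain f v where j: "j = (f, v)" "f \<in> proper" "v \<in> f" by auto
  then have f: "f \<in> crossed" "f \<in> E" using proper_subset crossed_subset by auto
  have "open_arc (half e u) \<inter> open_arc (half f v) = {}"
  proof (cases "e = f")
    case True
    then show ?thesis using h(4) i j \<open>i \<noteq> j\<close> by auto
  next
    case False
    then show ?thesis using half_disjoint_edge[OF e(1) i(3) f(2)] half(3)[OF f(1) j(3)] by blast
  qed
  then show "open_arc (case i of (e, u) \<Rightarrow> half e u) \<inter> open_arc (case j of (e, u) \<Rightarrow> half e u) = {}"
    using i j by simp
qed

text \<open>The star graph is bipartite between vertices and crossings. The endpoints around a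
  crossing are distinct because its two edges are disjoint, so there are no parallel edges and a
  core has at least four edges.\<close>

lemma proper_crossings_bound:
  assumes "card V \<ge> 4"
  shows "n_proper + 2 \<le> card V"
proof -
  let ?I = "SIGMA e:proper. e"
  interpret S: plane_graph "pos ` V \<union> crossing ` proper" ?I "\<lambda>(e, u). half e u"
    by (rule star_graph)
  have S_ends: "S.ends (e, u) = {pos u, crossing e}" if "(e, u) \<in> ?I" for e u
    using that half(2) proper_subset unfolding S.ends_def by auto
  have inc_pos: "w = u" if "(e, u) \<in> ?I" "pos w \<in> S.ends (e, u)" "w \<in> V" for e u w
  proof -
    have "e \<in> crossed" "u \<in> V" using that(1) proper_subset crossed_subset edge(1) by auto
    then show ?thesis using that(2) S_ends[OF that(1)] pos_eq_iff[OF that(3)] crossing_not_vertex[of e] imageI[OF that(3), of pos] by auto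
  qed
  have inc_crossing: "crossing f = crossing e" if "(e, u) \<in> ?I" "crossing f \<in> S.ends (e, u)" "f \<in> proper" for e u f
  proof -
    have "f \<in> crossed" "u \<in> V" using that(1,3) proper_subset crossed_subset edge(1) by auto
    then show ?thesis using that(2) S_ends[OF that(1)] crossing_not_vertex[of f] by auto
  qed
  have girth: "4 \<le> card (C \<inter> ?I)" if C: "C \<subseteq> ?I" "S.core C" for C
  proof -
    have next_at_crossing: "\<exists>e' u'. (e', u') \<in> C \<and> crossing e' = crossing e \<and> u' \<noteq> u" if eu: "(e, u) \<in> C" for e u
    proof -
      have I: "(e, u) \<in> ?I" using eu C by auto
      then obtain e' u' where *: "(e', u') \<in> C" "(e', u') \<noteq> (e, u)" "crossing e \<in> S.ends (e', u')"
        using C(2) eu S_ends[OF I] unfolding S.core_def by fastforce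
      then have I': "(e', u') \<in> ?I" using C by auto
      have cr: "crossing e = crossing e'" using inc_crossing[OF I' *(3)] I by auto
      moreover have "u' \<noteq> u"
        using crossing_eq[of e e'] cr I I' *(2) unfolding proper_def by auto
      ultimately show ?thesis using * by auto
    qed
    have next_at_vertex: "\<exists>e'. (e', u) \<in> C \<and> crossing e' \<noteq> crossing e" if eu: "(e, u) \<in> C" for e u
    proof -
      have I: "(e, u) \<in> ?I" using eu C by auto
      then have uV: "u \<in> V" using edge(1) proper_subset crossed_subset by auto
      obtain e' u' where *: "(e', u') \<in> C" "(e', u') \<noteq> (e, u)" "pos u \<in> S.ends (e', u')"
        using C(2) eu S_ends[OF I] unfolding S.core_def by fastforce
      then have I': "(e', u') \<in> ?I" using C by auto
      have "u' = u" using inc_pos[OF I' *(3) uV] by simp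
      moreover have "crossing e' \<noteq> crossing e"
        using crossing_eq[of e e'] I I' *(2) \<open>u' = u\<close> unfolding proper_def by auto
      ultimately show ?thesis using * by auto
    qed
    \<comment> \<open>The four edges come in two pairs: two at the crossing of \<open>e\<close>, and
      two at another crossing reached through \<open>u\<close>.\<close>
    obtain e u where 1: "(e, u) \<in> C" using C(2) unfolding S.core_def by auto
    obtain e2 u2 where 2: "(e2, u2) \<in> C" "crossing e2 = crossing e" "u2 \<noteq> u"
      using next_at_crossing[OF 1] by auto
    obtain e3 where 3: "(e3, u) \<in> C" "crossing e3 \<noteq> crossing e" using next_at_vertex[OF 1] by auto
    obtain e4 u4 where 4: "(e4, u4) \<in> C" "crossing e4 = crossing e3" "u4 \<noteq> u"
      using next_at_crossing[OF 3(1)] by auto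
    have "card {(e, u), (e2, u2), (e3, u), (e4, u4)} = 4"
      using 2 3 4 by (auto simp: card_insert_if)
    moreover have "{(e, u), (e2, u2), (e3, u), (e4, u4)} \<subseteq> C \<inter> ?I" using 1 2 3 4 C by auto
    ultimately show ?thesis
      using S.finite_I by (metis card_mono finite_Int)
  qed
  have "card ?I = (\<Sum>e\<in>proper. card e)"
  proof (rule card_SigmaI)
    show "finite proper" using finite_crossed proper_subset finite_subset by blast
    show "\<forall>e\<in>proper. finite e"
      using edge(1) proper_subset crossed_subset finite_V finite_subset by blast
  qed
  also have "\<dots> = (\<Sum>e\<in>proper. 2)"
    using edge(2) crossed_subset proper_subset by (intro sum.cong) auto
  also have "\<dots> = 4 * n_proper" using card_proper(1) by simp
  finally have I: "card ?I = 4 * n_proper" .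
  have "crossing e \<notin> pos ` V" if "e \<in> proper" for e
    using crossing_not_vertex that proper_subset by blast
  then have "crossing ` proper \<subseteq> - pos ` V" by (intro image_subsetI) simp
  then have "pos ` V \<inter> crossing ` proper = {}" by auto
  moreover have "finite (crossing ` proper)" using finite_crossed proper_subset finite_subset by blast
  ultimately have "card (pos ` V \<union> crossing ` proper) = card (pos ` V) + card (crossing ` proper)"
    using finite_V by (simp add: card_Un_disjoint)
  then have P: "card (pos ` V \<union> crossing ` proper) = card V + n_proper"
    using card_image[OF inj_pos] card_proper(2) by simp
  have "4 * n_proper + 1 \<le> card V + n_proper \<or> 4 * (4 * n_proper + 2) \<le> 2 * (4 * n_proper) + 4 * (card V + n_proper)"
    using S.weighted_girth_bound[of ?I 4] girth unfolding I P by blast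
  \<comment> \<open>The forest case reads \<open>3 * n_proper + 1 <= card V\<close>; for
    \<open>n_proper = 0\<close> the claim then comes from \<open>card V >= 4\<close>.\<close>
  then show ?thesis by (rule disjE) (use assms in simp_all)
qed

section \<open>Crossings of adjacent edges\<close>

definition bad where "bad = crossed - proper"

text \<open>For crossing edges \<open>ab\<close> and \<open>ad\<close> this is the common endpoint
  \<open>a\<close>; \<open>far\<close> gives \<open>b\<close> and \<open>d\<close>.\<close>

definition near where "near e = (SOME u. u \<in> e \<inter> partner e)"

definition far where "far e = (SOME u. u \<in> e \<and> u \<noteq> near e)"

lemma bad_subset: "bad \<subseteq> crossed" "bad \<inter> proper = {}" "crossed = bad \<union> proper"
  unfolding bad_def using proper_subset by auto

lemma finite_bad: "finite bad"
  using finite_crossed bad_subset(1) finite_subset by blast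

lemma partner_bad: "e \<in> bad \<Longrightarrow> partner e \<in> bad"
  using partner_proper[of "partner e"] partner[of e] unfolding bad_def by auto

text \<open>The two edges of a pair get the same \<open>near\<close> because both choices are made
  from the same intersection.\<close>

lemma near_far:
  assumes "e \<in> bad"
  shows "near e \<in> partner e" "e = {near e, far e}" "near e \<noteq> far e" "near (partner e) = near e"
proof -
  have e: "e \<in> crossed" "e \<in> E" using assms bad_subset(1) crossed_subset by auto
  have ex: "\<exists>u. u \<in> e \<inter> partner e" using assms e unfolding bad_def proper_def by auto
  have n: "near e \<in> e" "near e \<in> partner e" using someI_ex[OF ex] unfolding near_def by auto
  show "near e \<in> partner e" by (rule n(2))
  obtain v where v: "e = {near e, v}" "near e \<noteq> v"
    using edge(2)[OF e(2)] n(1) unfolding card_2_iff by (metis insertE insert_commute singletonD)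
  then have "\<exists>u. u \<in> e \<and> u \<noteq> near e" by blast
  from someI_ex[OF this, folded far_def] have "far e \<in> e" "far e \<noteq> near e" by auto
  then show "e = {near e, far e}" "near e \<noteq> far e" using v by blast+
  show "near (partner e) = near e"
    unfolding near_def partner(2)[OF e(1)] by (simp add: Int_commute)
qed

text \<open>A bad edge loses its half at the common endpoint; one spoke will replace that half for
  both edges of the pair.\<close>

definition trimmed where "trimmed e = (if e \<in> bad then half e (far e) else \<gamma> e)"

definition kept where "kept = E - (proper \<inter> chosen)"

text \<open>There is one spoke per bad crossing. A second one would have the same ends and form a
  core of weight zero with the first.\<close>

definition spokes where "spokes = bad \<inter> chosen"

lemma kept_subset: "kept \<subseteq> E" and finite_kept: "finite kept"
  unfolding kept_def using finite_E by auto

lemma spokes_subset: "spokes \<subseteq> bad" and finite_spokes: "finite spokes"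
  unfolding spokes_def using finite_bad by auto

lemma crossing_spokes: "crossing ` bad = crossing ` spokes"
proof (intro equalityI subsetI)
  fix p assume "p \<in> crossing ` bad"
  then obtain e where e: "e \<in> bad" "p = crossing e" by auto
  then have "p = crossing (partner e)" "e \<in> spokes \<or> partner e \<in> spokes"
    using partner(3) partner_chosen partner_bad bad_subset(1) unfolding spokes_def by auto
  then show "p \<in> crossing ` spokes" using e(2) by blast
qed (use spokes_subset in auto)

lemma trimmed:
  assumes "e \<in> E"
  shows "arc (trimmed e)" "open_arc (trimmed e) \<subseteq> open_arc (\<gamma> e)"
    "e \<in> bad \<Longrightarrow> crossing e \<notin> open_arc (trimmed e)"
    "{pathstart (trimmed e), pathfinish (trimmed e)} =
       (if e \<in> bad then {pos (far e), crossing e} else pos ` e)"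
proof -
  have h: "arc (half e (far e))" "open_arc (half e (far e)) \<subseteq> open_arc (\<gamma> e) - {crossing e}"
    "{pathstart (half e (far e)), pathfinish (half e (far e))} = {pos (far e), crossing e}" if "e \<in> bad"
  proof -
    have "e \<in> crossed" "far e \<in> e" using that near_far(2) bad_subset(1) by auto
    from half[OF this] show "arc (half e (far e))" "open_arc (half e (far e)) \<subseteq> open_arc (\<gamma> e) - {crossing e}"
    "{pathstart (half e (far e)), pathfinish (half e (far e))} = {pos (far e), crossing e}" by auto
  qed
  show "arc (trimmed e)" using h(1) arc[OF assms] unfolding trimmed_def by auto
  show "open_arc (trimmed e) \<subseteq> open_arc (\<gamma> e)" "e \<in> bad \<Longrightarrow> crossing e \<notin> open_arc (trimmed e)"
    using h(2) unfolding trimmed_def by auto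
  show "{pathstart (trimmed e), pathfinish (trimmed e)} =
       (if e \<in> bad then {pos (far e), crossing e} else pos ` e)"
    using h(3) ends[OF assms] unfolding trimmed_def by auto
qed

text \<open>A common point would be the crossing of \<open>e\<close> and \<open>f\<close>. If the
  pair is bad, trimming has removed this point; if it is proper, one of the two edges is not
  kept.\<close>

lemma trimmed_disjoint:
  assumes "e \<in> kept" "f \<in> kept" "e \<noteq> f"
  shows "open_arc (trimmed e) \<inter> open_arc (trimmed f) = {}"
proof (rule ccontr)
  assume "\<not> ?thesis"
  then obtain p where p: "p \<in> open_arc (trimmed e)" "p \<in> open_arc (trimmed f)" by auto
  have E: "e \<in> E" "f \<in> E" using assms kept_subset by auto
  have "p \<in> open_arc (\<gamma> e)" "p \<in> open_arc (\<gamma> f)"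
    using p trimmed(2)[OF E(1)] trimmed(2)[OF E(2)] by auto
  note cr = crossing_unique[OF E assms(3) this]
  show False
  proof (cases "e \<in> bad")
    case True
    then show False using trimmed(3)[OF E(1)] p cr by auto
  next
    case False
    then have "e \<in> proper" using cr(1) bad_subset by auto
    then show False using assms partner_chosen[OF cr(1)] partner_proper cr(2) unfolding kept_def by auto
  qed
qed

definition points where "points = pos ` V \<union> crossing ` bad"

text \<open>The sum type separates two roles of an edge: \<open>Inl\<close> marks a curve of weight
  one and \<open>Inr\<close> a spoke of weight zero. A bad edge can occur in both.\<close>

definition curve where "curve i = (case i of Inl e \<Rightarrow> trimmed e | Inr e \<Rightarrow> half e (near e))"

lemma curve_simps [simp]: "curve (Inl e) = trimmed e" "curve (Inr e) = half e (near e)"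
  unfolding curve_def by auto

lemma spoke:
  assumes "e \<in> spokes"
  shows "e \<in> crossed" "e \<in> bad" "e \<in> E" "near e \<in> e"
proof -
  show "e \<in> crossed" "e \<in> bad" "e \<in> E"
    using assms spokes_subset bad_subset(1) crossed_subset by auto
  then show "near e \<in> e" using near_far(2)[of e] by auto
qed

lemma spoke_disjoint_trimmed:
  assumes "e \<in> spokes" "f \<in> kept"
  shows "open_arc (half e (near e)) \<inter> open_arc (trimmed f) = {}"
proof (cases "e = f")
  case True
  have "far e \<in> e" "far e \<noteq> near e" using near_far[OF spoke(2)[OF assms(1)]] by auto
  then show ?thesis
    using True half(4)[OF spoke(1,4)[OF assms(1)]] spoke(2)[OF assms(1)] unfolding trimmed_def by auto
next
  case False
  have "f \<in> E" using assms kept_subset by auto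
  then show ?thesis
    using half_disjoint_edge[OF spoke(1,4)[OF assms(1)], of f] trimmed(2)[of f] False by blast
qed

lemma trimmed_graph: "plane_graph points (kept <+> spokes) curve"
proof
  show "finite points" "finite (kept <+> spokes)"
    unfolding points_def using finite_V finite_bad finite_kept finite_spokes by auto
  show "points \<noteq> {}" unfolding points_def using V_nonempty by auto
next
  fix i assume i: "i \<in> kept <+> spokes"
  have "arc (curve i) \<and> {pathstart (curve i), pathfinish (curve i)} \<subseteq> points \<and> open_arc (curve i) \<inter> points = {}"
  proof (cases i)
    case (Inl e)
    then have e: "e \<in> E" using i kept_subset by auto
    have eb: "far e \<in> V" if "e \<in> bad" using near_far(2)[OF that] edge(1)[OF e] by auto
    have ends_points: "{pathstart (trimmed e), pathfinish (trimmed e)} \<subseteq> points"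
      unfolding trimmed(4)[OF e] points_def using edge(1)[OF e] eb by auto
    have "crossing f \<notin> open_arc (trimmed e)" if f: "f \<in> bad" for f
    proof
      assume *: "crossing f \<in> open_arc (trimmed e)"
      then have "e = f \<or> e = partner f"
        using crossing_on_edge[of f e] f bad_subset(1) e trimmed(2)[OF e] by auto
      then have "e \<in> bad" "crossing e = crossing f"
        using f partner_bad partner(3)[of f] bad_subset(1) by auto
      then show False using trimmed(3)[OF e] * by auto
    qed
    then have "open_arc (trimmed e) \<inter> points = {}"
      unfolding points_def using trimmed(2)[OF e] avoid[OF e] by auto
    then show ?thesis using Inl trimmed(1)[OF e] ends_points by simp
  next
    case (Inr e)
    then have "e \<in> spokes" using i by auto
    note e = spoke[OF this]
    note h = half[OF e(1,4)]
    have "{pathstart (half e (near e)), pathfinish (half e (near e))} \<subseteq> points"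
      unfolding h(2) points_def using e edge(1)[OF e(3)] by auto
    moreover have "open_arc (half e (near e)) \<inter> points = {}"
      using h(3) avoid[OF e(3)] crossing_on_half[OF e(1) _ e(4)] bad_subset(1) unfolding points_def by blast
    ultimately show ?thesis using Inr h(1) by simp
  qed
  then show "arc (curve i)" "pathstart (curve i) \<in> points" "pathfinish (curve i) \<in> points"
    "open_arc (curve i) \<inter> points = {}" by auto
  fix j assume j: "j \<in> kept <+> spokes" "i \<noteq> j"
  show "open_arc (curve i) \<inter> open_arc (curve j) = {}"
  proof (cases i)
    case (Inl e)
    show ?thesis
    proof (cases j)
      case (Inl f)
      then show ?thesis using \<open>i = Inl e\<close> i j trimmed_disjoint[of e f] by auto
    next
      case (Inr f)
      then show ?thesis using \<open>i = Inl e\<close> i j spoke_disjoint_trimmed[of f e] by auto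
    qed
  next
    case (Inr e)
    show ?thesis
    proof (cases j)
      case (Inl f)
      then show ?thesis using \<open>i = Inr e\<close> i j spoke_disjoint_trimmed[of e f] by auto
    next
      case (Inr f)
      then have *: "e \<in> spokes" "f \<in> spokes" "f \<noteq> e" using \<open>i = Inr e\<close> i j by auto
      have "open_arc (half e (near e)) \<inter> open_arc (\<gamma> f) = {}"
        using half_disjoint_edge[OF spoke(1,4)[OF *(1)] spoke(3)[OF *(2)] *(3)] .
      then show ?thesis using half(3)[OF spoke(1,4)[OF *(2)]] \<open>i = Inr e\<close> Inr by auto
    qed
  qed
qed

text \<open>The weighted edges of a core, read as edges of the original graph, have minimum degree
  two there, so there are at least four of them. Each spoke adds one edge and one crossing point, so
  the spokes cancel in the final count.\<close>

lemma kept_bound: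
  assumes "card V \<ge> 4" "triangle_free E"
  shows "card kept + 4 \<le> 2 * card V"
proof -
  let ?I = "kept <+> spokes"
  interpret S: plane_graph points ?I curve by (rule trimmed_graph)
  have ends_l: "S.ends (Inl e) = (if e \<in> bad then {pos (far e), crossing e} else pos ` e)" if "e \<in> kept" for e
    unfolding S.ends_def curve_simps by (rule trimmed(4)[OF subsetD[OF kept_subset that]])
  have ends_r: "S.ends (Inr e) = {pos (near e), crossing e}" if "e \<in> spokes" for e
    unfolding S.ends_def using half(2)[OF spoke(1,4)[OF that]] by simp
  have inc_l: "u \<in> e \<and> (e \<in> bad \<longrightarrow> u = far e)"
    if "e \<in> kept" "u \<in> V" "pos u \<in> S.ends (Inl e)" for e u
  proof (cases "e \<in> bad")
    case True
    then have "far e \<in> e" "far e \<in> V" "e \<in> crossed"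
      using near_far(2)[OF True] edge(1)[of e] that(1) kept_subset bad_subset(1) by auto
    then show ?thesis
      using True that(3) ends_l[OF that(1)] pos_eq_iff[OF that(2)] crossing_not_vertex[of e]
        imageI[OF that(2), of pos] by auto
  next
    case False
    have "e \<subseteq> V" using that(1) kept_subset edge(1) by auto
    then show ?thesis using False that ends_l[OF that(1)] pos_eq_iff by auto
  qed
  have inc_r: "u = near e" if "e \<in> spokes" "u \<in> V" "pos u \<in> S.ends (Inr e)" for e u
  proof -
    have "near e \<in> V" using spoke[OF that(1)] edge(1) by auto
    then show ?thesis
      using that(3) ends_r[OF that(1)] pos_eq_iff[OF that(2)] imageI[OF that(2), of pos]
        crossing_not_vertex[OF spoke(1)[OF that(1)]] by auto
  qed
  have cr_l: "e \<in> bad \<and> (e = f \<or> e = partner f)"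
    if "e \<in> kept" "f \<in> bad" "crossing f \<in> S.ends (Inl e)" for e f
  proof -
    have f: "f \<in> crossed" using that(2) bad_subset(1) by auto
    have "crossing f \<notin> pos ` e" using crossing_not_vertex[OF f] that(1) kept_subset edge(1) by blast
    then have *: "e \<in> bad" using ends_l[OF that(1)] that(3) by (auto split: if_splits)
    then have "far e \<in> V" using near_far(2)[OF *] edge(1)[of e] that(1) kept_subset by auto
    then have "crossing f = crossing e"
      using ends_l[OF that(1)] that(3) * crossing_not_vertex[OF f] by auto
    then show ?thesis using * crossing_eq[of f e] f bad_subset(1) by auto
  qed
  have cr_r: "e = f \<or> e = partner f" if "e \<in> spokes" "f \<in> bad" "crossing f \<in> S.ends (Inr e)" for e f
  proof -
    have f: "f \<in> crossed" using that(2) bad_subset(1) by auto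
    have "near e \<in> V" using spoke[OF that(1)] edge(1) by auto
    then have "crossing f = crossing e"
      using ends_r[OF that(1)] that(3) crossing_not_vertex[OF f] by auto
    then show ?thesis using crossing_eq[of f e] f spoke(1)[OF that(1)] by auto
  qed
  have unique_spoke: "f = e" if "e \<in> spokes" "f \<in> spokes" "f = e \<or> f = partner e" for e f
    using that partner_chosen[OF spoke(1)[OF that(1)]] unfolding spokes_def by auto
  have girth: "4 \<le> card (C \<inter> Inl ` kept)" if C: "C \<subseteq> ?I" "S.core C" for C
  proof -
    define D where "D = {e \<in> kept. Inl e \<in> C}"
    have core: "\<exists>j\<in>C. j \<noteq> i \<and> v \<in> S.ends j" if "i \<in> C" "v \<in> S.ends i" for i v
      using C(2) that unfolding S.core_def by blast
    \<comment> \<open>A crossing has only one spoke, so the other edge of \<open>C\<close> at the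
      centre is a trimmed edge of the same pair; untrimmed, it contains
      \<open>near t\<close>.\<close>
    have spoke_D: "\<exists>e\<in>D. near t \<in> e \<and> (e = t \<or> e = partner t)" if t: "Inr t \<in> C" for t
    proof -
      have ts: "t \<in> spokes" using t C by auto
      then obtain k where k: "k \<in> C" "k \<noteq> Inr t" "crossing t \<in> S.ends k"
        using core[OF t, of "crossing t"] ends_r by auto
      show ?thesis
      proof (cases k)
        case (Inl e)
        then have e: "e \<in> kept" using k C by auto
        then have *: "e = t \<or> e = partner t" using cr_l[OF e spoke(2)[OF ts]] k Inl by auto
        then have "near t \<in> e" using spoke(4)[OF ts] near_far(1)[OF spoke(2)[OF ts]] by auto
        then show ?thesis using * e k Inl unfolding D_def by auto
      next
        case (Inr e)
        then have e: "e \<in> spokes" using k C by auto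
        then have "e = t" using cr_r[OF e spoke(2)[OF ts]] k Inr unique_spoke[OF ts e] by auto
        then show ?thesis using k Inr by auto
      qed
    qed
    \<comment> \<open>A spoke at \<open>u\<close> is followed to its centre, where an edge of its
      pair continues. The last premise keeps that edge from being \<open>e\<close>.\<close>
    have at_vertex: "\<exists>f\<in>D. f \<noteq> e \<and> u \<in> f"
      if j: "j \<in> C" "j \<noteq> Inl e" "pos u \<in> S.ends j" "u \<in> V" and e: "\<And>t. j = Inr t \<Longrightarrow> e \<noteq> t \<and> e \<noteq> partner t"
      for j e u
    proof (cases j)
      case (Inl f)
      then have "f \<in> kept" using j C by auto
      then show ?thesis using inc_l[of f u] j Inl unfolding D_def by auto
    next
      case (Inr t)
      then have t: "t \<in> spokes" using j C by auto
      then have "u = near t" using inc_r[OF t] j Inr by auto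
      then show ?thesis using spoke_D[of t] j(1) Inr e[OF Inr] by auto
    qed
    have deg: "\<exists>f\<in>D. f \<noteq> e \<and> u \<in> f" if e: "e \<in> D" "u \<in> e" for e u
    proof -
      have eC: "Inl e \<in> C" "e \<in> kept" using e unfolding D_def by auto
      have uV: "u \<in> V" using e(2) eC(2) kept_subset edge(1) by auto
      show ?thesis
      proof (cases "pos u \<in> S.ends (Inl e)")
        case True
        then obtain j where j: "j \<in> C" "j \<noteq> Inl e" "pos u \<in> S.ends j" using core[OF eC(1)] by auto
        \<comment> \<open>A spoke of the pair of \<open>e\<close> ends at the vertex
          \<open>near e\<close>, whereas the trimmed \<open>e\<close> reaches only
          \<open>far e\<close>.\<close>
        have "e \<noteq> t \<and> e \<noteq> partner t" if jt: "j = Inr t" for t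
        proof (rule ccontr)
          assume n: "\<not> (e \<noteq> t \<and> e \<noteq> partner t)"
          have t: "t \<in> spokes" using j C jt by auto
          then have "e \<in> bad" "near e = near t"
            using n spoke(2)[OF t] partner_bad near_far(4)[of t] by auto
          moreover have "u = near t" using inc_r[OF t uV] j jt by auto
          ultimately show False using inc_l[OF eC(2) uV True] near_far(3)[of e] by auto
        qed
        then show ?thesis using at_vertex[OF j uV] by blast
      next
        case False
        \<comment> \<open>Here \<open>u\<close> is the endpoint that trimming cut off, so the search
          starts at the crossing: it meets there either the partner, or the spoke, which leads to
          \<open>u\<close> and on to a further edge.\<close>
        have eb: "e \<in> bad" using False ends_l[OF eC(2)] e(2) by (auto split: if_splits)
        have "u \<noteq> far e" using False ends_l[OF eC(2)] eb by auto
        then have u: "u = near e" using near_far(2)[OF eb] e(2) by auto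
        obtain j where j: "j \<in> C" "j \<noteq> Inl e" "crossing e \<in> S.ends j"
          using core[OF eC(1), of "crossing e"] ends_l[OF eC(2)] eb by auto
        show ?thesis
        proof (cases j)
          case (Inl f)
          then have f: "f \<in> kept" using j C by auto
          then have "f = partner e" using cr_l[OF f eb] j Inl by auto
          then show ?thesis using f j Inl u near_far(1)[OF eb] unfolding D_def by auto
        next
          case (Inr t)
          then have t: "t \<in> spokes" using j C by auto
          have te: "t = e \<or> t = partner e" using cr_r[OF t eb] j Inr by auto
          then have nt: "near t = u" using near_far(4)[OF eb] u by auto
          then have "pos u \<in> S.ends (Inr t)" using ends_r[OF t] by auto
          then obtain k where k: "k \<in> C" "k \<noteq> Inr t" "pos u \<in> S.ends k" using core[of "Inr t"] j(1) Inr by auto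
          have "k \<noteq> Inl e" using k False by auto
          moreover have "e \<noteq> s \<and> e \<noteq> partner s" if ks: "k = Inr s" for s
          proof (rule ccontr)
            assume n: "\<not> (e \<noteq> s \<and> e \<noteq> partner s)"
            have s: "s \<in> spokes" using k C ks by auto
            have "s = e \<or> s = partner e" using n partner(2)[OF spoke(1)[OF s]] by auto
            then have "s = t \<or> s = partner t" using te partner(2)[of e] eb bad_subset(1) by auto
            then show False using unique_spoke[OF t s] k ks by auto
          qed
          ultimately show ?thesis using at_vertex[OF k(1) _ k(3) uV] by blast
        qed
      qed
    qed
    have "D \<noteq> {}"
    proof -
      obtain i where "i \<in> C" using C(2) unfolding S.core_def by auto
      then show ?thesis using C(1) spoke_D unfolding D_def by (cases i) auto
    qed
    moreover have "triangle_free D"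
      using assms(2) kept_subset unfolding triangle_free_def D_def by blast
    moreover have "finite D" unfolding D_def using finite_kept by simp
    moreover have "card e = 2" if "e \<in> D" for e using that kept_subset edge(2) unfolding D_def by auto
    ultimately have "4 \<le> card D" using deg by (intro triangle_free_min_degree_2)
    also have "\<dots> = card (Inl ` D :: ('a set + 'a set) set)" by (simp add: card_image)
    also have "\<dots> \<le> card (C \<inter> Inl ` kept)"
      using finite_kept unfolding D_def by (intro card_mono) auto
    finally show ?thesis .
  qed
  have I: "card ?I = card kept + card spokes"
    using finite_kept finite_spokes by (simp add: card_Plus)
  have W: "card (Inl ` kept :: ('a set + 'a set) set) = card kept" by (simp add: card_image)
  have P: "card points = card V + card spokes"
  proof -
    have "crossing e \<notin> pos ` V" if "e \<in> bad" for e
      using crossing_not_vertex that bad_subset(1) by blast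
    then have "crossing ` bad \<subseteq> - pos ` V" by (intro image_subsetI) simp
    then have "pos ` V \<inter> crossing ` bad = {}" by auto
    then have "card points = card (pos ` V) + card (crossing ` bad)"
      unfolding points_def using finite_V finite_bad by (simp add: card_Un_disjoint)
    moreover have "inj_on crossing spokes"
      using inj_on_crossing_chosen inj_on_subset unfolding spokes_def by blast
    then have "card (crossing ` bad) = card spokes" unfolding crossing_spokes by (rule card_image)
    ultimately show ?thesis using card_image[OF inj_pos] by simp
  qed
  have "card ?I + 1 \<le> card points \<or>
      4 * (card ?I + 2) \<le> 2 * card (Inl ` kept :: ('a set + 'a set) set) + 4 * card points"
    by (rule S.weighted_girth_bound) (use girth in auto)
  \<comment> \<open>In the forest case \<open>card kept + 1 <= card V\<close>, and
    \<open>card V >= 4\<close> makes this enough.\<close>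
  then show ?thesis
    unfolding I W P by (rule disjE) (use assms(1) in simp_all)
qed

lemma edge_bound:
  assumes "card V \<ge> 4" "triangle_free E"
  shows "card E \<le> 3 * (card V - 2)"
proof -
  have "proper \<inter> chosen \<subseteq> E" using proper_subset crossed_subset by auto
  then have "card kept = card E - n_proper" "n_proper \<le> card E"
    unfolding kept_def n_proper_def using finite_E by (auto intro: card_Diff_subset card_mono finite_subset)
  then show ?thesis
    using kept_bound[OF assms] proper_crossings_bound[OF assms(1)] by linarith
qed

end

section \<open>Transfer from the given drawing to the complex plane\<close>

theorem theorem5:
  fixes V :: "'a set" and E :: "'a set set"
  assumes "simple_graph V E"
    and "card V \<ge> 4"
    and "triangle_free E"
    and "k_planar 1 V E"
  shows "card E \<le> 3 * (card V - 2)"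
proof -
  obtain pos \<gamma> where d: "k_planar_drawing 1 V E pos \<gamma>" using assms(4) unfolding k_planar_def by auto
  \<comment> \<open>This linear injection carries the drawing to \<open>complex\<close>, the setting
    of the Jordan and Janiszewski theorems.\<close>
  define \<Phi> where "\<Phi> = (\<lambda>p::real \<times> real. Complex (fst p) (snd p))"
  have \<Phi>: "linear \<Phi>" "inj \<Phi>"
    unfolding \<Phi>_def by (auto intro!: linearI injI simp: complex_eq_iff prod_eq_iff)
  have open_arc: "open_arc (\<Phi> \<circ> g) = \<Phi> ` arc_interior g" for g
    unfolding open_arc_def arc_interior_def by (simp add: image_comp)
  have drawing: "arc (\<gamma> e)" "\<exists>u v. e = {u, v} \<and> pathstart (\<gamma> e) = pos u \<and> pathfinish (\<gamma> e) = pos v"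
    "\<And>x. x \<in> V \<Longrightarrow> pos x \<notin> arc_interior (\<gamma> e)" "finite (crossings E \<gamma> e)" "card (crossings E \<gamma> e) \<le> 1"
    if "e \<in> E" for e
    using d that unfolding k_planar_drawing_def by auto
  interpret one_planar V E "\<Phi> \<circ> pos" "\<lambda>e. \<Phi> \<circ> \<gamma> e"
  proof
    show "finite V" "V \<noteq> {}" "\<And>e. e \<in> E \<Longrightarrow> e \<subseteq> V" "\<And>e. e \<in> E \<Longrightarrow> card e = 2"
      using assms(1,2) unfolding simple_graph_def by auto
    have "inj_on pos V" using d unfolding k_planar_drawing_def by auto
    then show "inj_on (\<Phi> \<circ> pos) V" using \<Phi>(2) by (meson comp_inj_on inj_on_subset subset_UNIV)
  next
    fix e assume e: "e \<in> E"
    show "arc (\<Phi> \<circ> \<gamma> e)" using drawing(1)[OF e] \<Phi> by (simp add: arc_linear_image_eq)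
    obtain u v where "e = {u, v}" "pathstart (\<gamma> e) = pos u" "pathfinish (\<gamma> e) = pos v"
      using drawing(2)[OF e] by auto
    then show "{pathstart (\<Phi> \<circ> \<gamma> e), pathfinish (\<Phi> \<circ> \<gamma> e)} = (\<Phi> \<circ> pos) ` e"
      by (simp add: pathstart_def pathfinish_def)
    show "open_arc (\<Phi> \<circ> \<gamma> e) \<inter> (\<Phi> \<circ> pos) ` V = {}"
      using drawing(3)[OF e] \<Phi>(2) unfolding open_arc by (auto simp: inj_eq)
    fix f f' p p'
    assume f: "f \<in> E" "f' \<in> E" "f \<noteq> e" "f' \<noteq> e" "p \<in> open_arc (\<Phi> \<circ> \<gamma> e)" "p \<in> open_arc (\<Phi> \<circ> \<gamma> f)"
      "p' \<in> open_arc (\<Phi> \<circ> \<gamma> e)" "p' \<in> open_arc (\<Phi> \<circ> \<gamma> f')"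
    then obtain q q' where q: "p = \<Phi> q" "p' = \<Phi> q'" "q \<in> arc_interior (\<gamma> e)" "q' \<in> arc_interior (\<gamma> e)"
      unfolding open_arc by auto
    then have "q \<in> arc_interior (\<gamma> f)" "q' \<in> arc_interior (\<gamma> f')"
      using f \<Phi>(2) unfolding open_arc by (auto simp: inj_eq)
    then have "(f, q) \<in> crossings E \<gamma> e" "(f', q') \<in> crossings E \<gamma> e"
      using f q unfolding crossings_def by auto
    \<comment> \<open>Crossings are pairs of an edge and a point, so the bound of one identifies
      both components.\<close>
    then have "(f, q) = (f', q')"
      using drawing(4,5)[OF e] by (metis One_nat_def card_le_Suc0_iff_eq)
    then show "f = f' \<and> p = p'" using q by simp
  qed
  show ?thesis using edge_bound assms by simp
qed

end
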